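(* Let $X,Y$ be real Hilbert spaces, $T:X\to Y$ a bounded linear map, $f\in Y$, and assume that $Tu=f$ has a unique solution $u^*\in X$. Let $E(u)=\frac12\|Tu-f\|_Y^2$ for $u\in X$ and $a(u,v)=\langle Tu,Tv\rangle_Y$ for $u,v\in X$. Assume that there are a (semi-)norm $|||\cdot|||_X$ on $X$ and $\alpha>0$ with $a(u,u)\ge \alpha|||u|||_X^2$ for all $u\in X$. Let $\mathcal F_\Theta=\{u_\theta:\theta\in\Theta\}$ be a subset of $X$ and let $L:\Theta\to\mathbb R$. Then for an arbitrary $\theta^*\in\Theta$ (with corresponding element $u_{\theta^*}\in\mathcal F_\Theta$), $$|||u_{\theta^*}-u^*|||_X^2\le \frac{2}{\alpha}\bigl(L(\theta^* )+\eta(\theta^* )\bigr),\qquad \eta(\theta^* )=E(u_{\theta^*})-L(\theta^* ).$$ If moreover, for some $C>0$ and $\eta>0$, $\sup_{\theta\in\Theta,\,|\theta|_\infty\le C}|E(u_\theta)-L(\theta)|\le\eta$ and $|\theta^*|_\infty\le C$, then $\eta(\theta^* )\le\eta$.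
   Context: $\Theta\subset\mathbb R^p$ is a parameter space and $\mathcal F_\Theta$ is the ansatz class, i.e. the collection of neural network functions $u_\theta$ with parameters $\theta\in\Theta$ (only the inclusion $\mathcal F_\Theta\subset X$ is relevant). $|\theta|_\infty$ is the maximum norm of the parameter vector. $L$ is a computable loss function discretizing the energy $\theta\mapsto E(u_\theta)$. The element $\theta^*$ is the output of some inexact optimization procedure for $L$; no optimality is required. *)

theory Defs
  imports "HOL-Analysis.Analysis"
begin

definition seminorm :: "('x::real_vector \<Rightarrow> real) \<Rightarrow> bool" where
  "seminorm N \<longleftrightarrow>
     (\<forall>x. N x \<ge> 0) \<and>
     (\<forall>c x. N (c *\<^sub>R x) = \<bar>c\<bar> * N x) \<and>
     (\<forall>x y. N (x + y) \<le> N x + N y)"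

definition energy :: "('x \<Rightarrow> 'y::real_inner) \<Rightarrow> 'y \<Rightarrow> 'x \<Rightarrow> real" where
  "energy T f u = 1/2 * (norm (T u - f))\<^sup>2"

definition energy_form :: "('x \<Rightarrow> 'y::real_inner) \<Rightarrow> 'x \<Rightarrow> 'x \<Rightarrow> real" where
  "energy_form T u v = T u \<bullet> T v"

definition discretization_error ::
    "('x \<Rightarrow> 'y::real_inner) \<Rightarrow> 'y \<Rightarrow> ('p \<Rightarrow> 'x) \<Rightarrow> ('p \<Rightarrow> real) \<Rightarrow> 'p \<Rightarrow> real" where
  "discretization_error T f u L \<theta> = energy T f (u \<theta>) - L \<theta>"

end

theory Submission
  imports Defs
begin

text \<open>Since \<open>T ustar = f\<close>, the residual at \<open>u \<theta>star\<close> is the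
  image under \<open>T\<close> of the error \<open>u \<theta>star - ustar\<close>. Hence the energy
  there is half the quadratic form of the error, and coercivity turns it into a bound on the
  seminorm of the error. The loss enters by splitting the energy into \<open>L \<theta>star\<close>
  plus the discretization error.\<close>

(* infnorm is the maximum norm on real ^ 'p.  The supremum is taken in ereal,
   so that it is infinite, and not unspecified, if the errors are unbounded. *)
theorem theorem1:
  fixes T :: "'x::{real_inner, complete_space} \<Rightarrow> 'y::{real_inner, complete_space}"
    and f :: 'y
    and ustar :: 'x
    and N :: "'x \<Rightarrow> real"
    and \<alpha> :: real
    and \<Theta> :: "(real ^ 'p) set"
    and u :: "real ^ 'p \<Rightarrow> 'x"
    and F :: "'x set"
    and L :: "real ^ 'p \<Rightarrow> real"
    and \<theta>star :: "real ^ 'p"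
  assumes "bounded_linear T"
    and "T ustar = f"
    and "\<And>v. T v = f \<Longrightarrow> v = ustar"
    and "seminorm N"
    and "\<alpha> > 0"
    and "\<And>v. energy_form T v v \<ge> \<alpha> * (N v)\<^sup>2"
    and "F = u ` \<Theta>"
    and "\<theta>star \<in> \<Theta>"
  shows "(N (u \<theta>star - ustar))\<^sup>2
           \<le> 2 / \<alpha> * (L \<theta>star + discretization_error T f u L \<theta>star)
       \<and> (\<forall>C \<eta>. C > 0 \<longrightarrow> \<eta> > 0 \<longrightarrow>
            (SUP \<theta>\<in>{\<theta> \<in> \<Theta>. infnorm \<theta> \<le> C}. ereal \<bar>energy T f (u \<theta>) - L \<theta>\<bar>) \<le> ereal \<eta> \<longrightarrow>
            infnorm \<theta>star \<le> C \<longrightarrow>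
            discretization_error T f u L \<theta>star \<le> \<eta>)"
proof (intro conjI allI impI)
  have "T (u \<theta>star - ustar) = T (u \<theta>star) - f"
    using assms(1,2) by (simp add: bounded_linear.linear linear_diff)
  \<comment> \<open>Coercivity at the error; the 2 undoes the factor 1/2 in
    \<open>energy\<close>.\<close>
  then have "\<alpha> * (N (u \<theta>star - ustar))\<^sup>2 \<le> 2 * energy T f (u \<theta>star)"
    using assms(6)[of "u \<theta>star - ustar"]
    by (simp add: energy_form_def energy_def power2_norm_eq_inner)
  \<comment> \<open>\<open>L \<theta>star\<close> cancels, so the bracket is exactly the energy at
    \<open>u \<theta>star\<close>.\<close>
  then show "(N (u \<theta>star - ustar))\<^sup>2
      \<le> 2 / \<alpha> * (L \<theta>star + discretization_error T f u L \<theta>star)"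
    using \<open>\<alpha> > 0\<close> by (simp add: discretization_error_def field_simps)
next
  fix C \<eta> :: real
  assume "(SUP \<theta>\<in>{\<theta> \<in> \<Theta>. infnorm \<theta> \<le> C}. ereal \<bar>energy T f (u \<theta>) - L \<theta>\<bar>) \<le> ereal \<eta>"
    and "infnorm \<theta>star \<le> C"
  \<comment> \<open>A bound on the supremum bounds every member of the family, and
    \<open>\<theta>star\<close> lies in the index set.\<close>
  then have "\<bar>energy T f (u \<theta>star) - L \<theta>star\<bar> \<le> \<eta>"
    using assms(8) by (simp add: SUP_le_iff)
  then show "discretization_error T f u L \<theta>star \<le> \<eta>"
    by (simp add: discretization_error_def)
qed

end
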